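(* Let $d\ge1$, $\Omega=[0,1)^d$, and fix $\eta\in(0,1)$. Let an index set $I\subset\mathbb{Z}^d$ with finite cardinality $|I|$, a real number $\alpha>1/2$, and product weights $\boldsymbol{\gamma}=(\gamma_1,\gamma_2,\ldots)\in[0,1]^{\mathbb{N}}$ be given. There exists a positive integer $N^*$, which depends on $d$, $\alpha$ and $\boldsymbol{\gamma}$, such that, for any prime $N\ge N^*$, the $N$-point rank-1 lattice rule with a suitable choice of the generating vector $\boldsymbol{z}\in\{1,\ldots,N-1\}^d$ satisfies $$\left|\frac1N\sum_{n=0}^{N-1}|p(\boldsymbol{x}_n)|^2-\int_\Omega|p(\boldsymbol{x})|^2\,d\boldsymbol{x}\right|\le\eta\int_\Omega|p(\boldsymbol{x})|^2\,d\boldsymbol{x}\qquad\text{for all }p\in\mathbb{P}_I(\Omega),$$ where $\boldsymbol{x}_0,\ldots,\boldsymbol{x}_{N-1}$ are the points of the rank-1 lattice point set $P_{N,\boldsymbol{z}}$ and $\mathbb{P}_I(\Omega)=\mathrm{span}\{\exp(2\pi i\,\boldsymbol{h}\cdot\boldsymbol{x}):\boldsymbol{h}\in I\}$.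
   Context: For an integer $N\ge2$ and $\boldsymbol{z}=(z_1,\ldots,z_d)\in\{1,\ldots,N-1\}^d$, the rank-1 lattice point set $P_{N,\boldsymbol{z}}$ consists of the $N$ points $\boldsymbol{x}_n=\left(\{nz_1/N\},\ldots,\{nz_d/N\}\right)$, $0\le n<N$, where $\{x\}=x-\lfloor x\rfloor$ is the fractional part. The rank-1 lattice rule is the equal-weight quadrature rule $\frac1N\sum_{n=0}^{N-1}f(\boldsymbol{x}_n)$ over these points. Here $\mathrm{span}$ is the complex linear span. The parameters $\alpha$ (smoothness) and $\boldsymbol{\gamma}$ (product weights) are those of the weighted Korobov space of periodic functions on $\Omega$ with norm $\left(\sum_{\boldsymbol{h}\in\mathbb{Z}^d}r_{\alpha,\boldsymbol{\gamma}}(\boldsymbol{h})^2|\hat f(\boldsymbol{h})|^2\right)^{1/2}$, where $\hat f(\boldsymbol{h})$ are the Fourier coefficients of $f$ and $r_{\alpha,\boldsymbol{\gamma}}(\boldsymbol{h})=\prod_{j:\,h_j\ne0}|h_j|^\alpha/\gamma_j$.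
   Formalization: N* is allowed to depend on the index set I and on η, not only on d, α and γ; an N* independent of I is impossible, since for I={0,N e_1} the polynomial 1-exp(2πi N x_1) vanishes at all N lattice points. *)

theory Defs
  imports "HOL-Analysis.Analysis" "HOL-Library.Function_Algebras"
    "HOL-Computational_Algebra.Primes"
begin

definition unit_cube :: "(real ^ 'd) set" where
  "unit_cube = {x. \<forall>j. 0 \<le> x $ j \<and> x $ j < 1}"

definition lattice_point :: "nat \<Rightarrow> nat ^ 'd \<Rightarrow> nat \<Rightarrow> real ^ 'd" where
  "lattice_point N z n = (\<chi> j. frac (real n * real (z $ j) / real N))"

definition lattice_rule :: "nat \<Rightarrow> nat ^ 'd \<Rightarrow> (real ^ 'd \<Rightarrow> real) \<Rightarrow> real" where
  "lattice_rule N z f = (\<Sum>n<N. f (lattice_point N z n)) / real N"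

definition fourier_exp :: "int ^ 'd \<Rightarrow> real ^ 'd \<Rightarrow> complex" where
  "fourier_exp h x =
     exp (2 * of_real pi * \<i> * of_real (\<Sum>j\<in>UNIV. real_of_int (h $ j) * x $ j))"

text \<open>The span is taken over the complex scalars, with pointwise operations on functions
  (the default \<^const>\<open>span\<close> would be real).  The trigonometric
  polynomials are kept in their periodic form on the whole space; restricting them to the unit
  cube yields the functions on the cube.\<close>

definition fun_scale :: "complex \<Rightarrow> ('a \<Rightarrow> complex) \<Rightarrow> 'a \<Rightarrow> complex" where
  "fun_scale c f = (\<lambda>x. c * f x)"

interpretation complex_fun: vector_space "fun_scale :: complex \<Rightarrow> ('a \<Rightarrow> complex) \<Rightarrow> 'a \<Rightarrow> complex"
  by unfold_locales (auto simp: fun_scale_def fun_eq_iff algebra_simps)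

definition trig_polys :: "(int ^ 'd) set \<Rightarrow> (real ^ 'd \<Rightarrow> complex) set" where
  "trig_polys I = complex_fun.span (fourier_exp ` I)"

end

theory Submission
  imports Defs "HOL-Computational_Algebra.Polynomial"
begin

text \<open>Fix positive integers \<open>z\<^sub>j\<close> such that \<open>h \<cdot> z \<noteq> 0\<close> for every nonzero difference \<open>h\<close> of two
  frequencies in \<open>I\<close>.  As soon as \<open>N\<close> exceeds all the numbers \<open>\<bar>h \<cdot> z\<bar>\<close>, no \<open>h \<cdot> z\<close> is divisible by \<open>N\<close>,
  so the lattice rule integrates every \<open>\<bar>p\<bar>\<^sup>2\<close> exactly and the error is zero.\<close>

section \<open>Choosing a generating vector\<close>

text \<open>For \<open>z\<close> with entries \<open>b ^ f j\<close>, the product of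
  \<open>h\<close> and \<open>z\<close> is the value at \<open>b\<close> of a polynomial whose
  coefficients are the entries of \<open>h\<close>. Nonzero polynomials have finitely many roots, so
  all but finitely many \<open>b\<close> work.\<close>

lemma exists_separating_vector:
  fixes D :: "(int ^ 'd) set"
  assumes "finite D" and "0 \<notin> D"
  shows "\<exists>z :: nat ^ 'd. (\<forall>j. 0 < z $ j) \<and> (\<forall>h\<in>D. (\<Sum>j\<in>UNIV. h $ j * int (z $ j)) \<noteq> 0)"
proof -
  obtain f :: "'d \<Rightarrow> nat" where f: "inj f"
    using finite_imp_inj_to_nat_seg[of "UNIV :: 'd set"] by auto
  define P where "P h = (\<Sum>j\<in>UNIV. monom (h $ j) (f j))" for h :: "int ^ 'd"
  have P_eval: "poly (P h) x = (\<Sum>j\<in>UNIV. h $ j * x ^ f j)" for h x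
    by (simp add: P_def poly_sum poly_monom)
  have P_nonzero: "P h \<noteq> 0" if "h \<in> D" for h
  proof -
    \<comment> \<open>Injectivity of \<open>f\<close> gives each coordinate its own degree, so no
      two entries of \<open>h\<close> can cancel.\<close>
    have "coeff (P h) (f k) = (\<Sum>j\<in>UNIV. if j = k then h $ j else 0)" for k
      unfolding P_def coeff_sum by (intro sum.cong) (auto simp: inj_eq[OF f])
    then have coeff: "coeff (P h) (f k) = h $ k" for k
      by simp
    have "h \<noteq> 0"
      using that assms(2) by auto
    then obtain k where "h $ k \<noteq> 0"
      by (auto simp: vec_eq_iff)
    then show ?thesis
      using coeff[of k] by auto
  qed
  \<comment> \<open>Besides the roots, 0 is excluded, so that all powers of \<open>b\<close> are
    positive.\<close>
  define R where "R = insert 0 (\<Union>h\<in>D. {x. poly (P h) x = 0})"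
  have "finite R"
    unfolding R_def using assms(1) P_nonzero by (auto intro: poly_roots_finite)
  then have "finite (int -` R)"
    by (intro finite_vimageI) (auto simp: inj_def)
  then obtain b :: nat where "b \<notin> int -` R"
    using ex_new_if_finite[OF infinite_UNIV_nat] by blast
  then have "0 < b" and "\<forall>h\<in>D. poly (P h) (int b) \<noteq> 0"
    by (auto simp: R_def)
  then show ?thesis
    by (intro exI[of _ "\<chi> j. b ^ f j"]) (auto simp: P_eval)
qed

section \<open>Characters and trigonometric polynomials\<close>

lemma fourier_exp_add: "fourier_exp (h + k) x = fourier_exp h x * fourier_exp k x"
  by (simp add: fourier_exp_def exp_add[symmetric] sum.distrib algebra_simps)

lemma cnj_fourier_exp: "cnj (fourier_exp h x) = fourier_exp (- h) x"
  by (simp add: fourier_exp_def exp_cnj sum_negf)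

lemma fourier_exp_mult_cnj: "fourier_exp h x * cnj (fourier_exp k x) = fourier_exp (h - k) x"
  by (simp add: cnj_fourier_exp fourier_exp_add[symmetric])

lemma fourier_exp_0: "fourier_exp 0 x = 1"
  by (simp add: fourier_exp_def)

text \<open>The functions of this form are a complex subspace containing the generators, hence
  contain the span.\<close>

lemma trig_polys_eq_sum:
  assumes "finite I" and "p \<in> trig_polys I"
  shows "\<exists>c. \<forall>x. p x = (\<Sum>h\<in>I. c h * fourier_exp h x)"
proof -
  let ?S = "{p. \<exists>c. \<forall>x. p x = (\<Sum>h\<in>I. c h * fourier_exp h x)}"
  have "complex_fun.subspace ?S"
  proof (rule complex_fun.subspaceI)
    show "0 \<in> ?S"
      by (auto intro: exI[of _ "\<lambda>_. 0"])
  next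
    fix p q assume "p \<in> ?S" and "q \<in> ?S"
    then obtain c d where "\<forall>x. p x = (\<Sum>h\<in>I. c h * fourier_exp h x)"
      and "\<forall>x. q x = (\<Sum>h\<in>I. d h * fourier_exp h x)"
      by auto
    then show "p + q \<in> ?S"
      by (auto intro!: exI[of _ "\<lambda>h. c h + d h"] simp: sum.distrib algebra_simps)
  next
    fix a p assume "p \<in> ?S"
    then obtain c where "\<forall>x. p x = (\<Sum>h\<in>I. c h * fourier_exp h x)"
      by auto
    then show "fun_scale a p \<in> ?S"
      by (auto intro!: exI[of _ "\<lambda>h. a * c h"] simp: fun_scale_def sum_distrib_left mult.assoc)
  qed
  moreover have "fourier_exp ` I \<subseteq> ?S"
  proof clarify
    fix k assume "k \<in> I"
    then have "\<forall>x. fourier_exp k x = (\<Sum>h\<in>I. (if h = k then 1 else 0) * fourier_exp h x)"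
      using assms(1) by (simp add: if_distrib[of "\<lambda>a. a * _"] sum.delta cong: if_cong)
    then show "\<exists>c. \<forall>x. fourier_exp k x = (\<Sum>h\<in>I. c h * fourier_exp h x)"
      by (rule exI[where x = "\<lambda>h. if h = k then 1 else 0"])
  qed
  ultimately have "trig_polys I \<subseteq> ?S"
    unfolding trig_polys_def by (rule complex_fun.span_minimal[rotated])
  then show ?thesis
    using assms(2) by auto
qed

section \<open>Character sums over the lattice points\<close>

text \<open>The base is an \<open>N\<close>-th root of unity other than 1, so the geometric sum has
  numerator 0.\<close>

lemma sum_character:
  fixes m :: int
  assumes "N > 0" and "\<not> int N dvd m"
  shows "(\<Sum>n<N. exp (2 * of_real pi * \<i> * of_real (of_int m / real N)) ^ n) = 0"
proof -
  define w where "w = exp (2 * of_real pi * \<i> * of_real (of_int m / real N))"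
  have "w ^ N = exp (of_nat N * (2 * of_real pi * \<i> * of_real (of_int m / real N)))"
    unfolding w_def by (simp only: exp_of_nat_mult)
  also have "of_nat N * (2 * of_real pi * \<i> * of_real (of_int m / real N)) = of_int m * (2 * of_real pi * \<i>)"
    using assms(1) by simp
  also have "exp (of_int m * (2 * of_real pi * \<i>)) = 1"
    by (auto simp: exp_eq_1 intro: exI[of _ m])
  finally have "w ^ N = 1" .
  moreover have "w \<noteq> 1"
  proof
    assume "w = 1"
    then obtain k :: int where "2 * pi * (of_int m / real N) = of_int (2 * k) * pi"
      by (auto simp: w_def exp_eq_1)
    then have "of_int m = of_int k * real N"
      using assms(1) by (simp add: field_simps)
    then have "m = k * int N"
      by (metis of_int_eq_iff of_int_mult of_int_of_nat_eq)
    then show False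
      using assms(2) by simp
  qed
  ultimately show ?thesis
    unfolding w_def[symmetric] by (simp add: geometric_sum)
qed

text \<open>Passing to fractional parts changes the phase by an integer multiple of 2 pi only. The
  power form prepares the geometric sum.\<close>

lemma fourier_exp_lattice_point:
  "fourier_exp h (lattice_point N z n) =
     exp (2 * of_real pi * \<i> * of_real (of_int (\<Sum>j\<in>UNIV. h $ j * int (z $ j)) / real N)) ^ n"
proof -
  let ?y = "\<lambda>j. real n * real (z $ j) / real N"
  let ?K = "\<Sum>j\<in>UNIV. h $ j * \<lfloor>?y j\<rfloor>"
  let ?m = "\<Sum>j\<in>UNIV. h $ j * int (z $ j)"
  have "(\<Sum>j\<in>UNIV. of_int (h $ j) * frac (?y j)) = (\<Sum>j\<in>UNIV. of_int (h $ j) * ?y j) - of_int ?K"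
    by (simp add: frac_def algebra_simps sum_subtractf)
  also have "(\<Sum>j\<in>UNIV. of_int (h $ j) * ?y j) = real n * (of_int ?m / real N)"
    by (simp add: sum_distrib_left sum_divide_distrib mult_ac)
  finally have "fourier_exp h (lattice_point N z n) =
      exp (2 * of_real pi * \<i> * of_real (real n * (of_int ?m / real N) - of_int ?K))"
    by (simp add: fourier_exp_def lattice_point_def)
  also have "\<dots> = exp (of_nat n * (2 * of_real pi * \<i> * of_real (of_int ?m / real N)))"
    unfolding exp_eq by (rule exI[of _ "- ?K"]) (simp add: algebra_simps)
  also have "\<dots> = exp (2 * of_real pi * \<i> * of_real (of_int ?m / real N)) ^ n"
    by (rule exp_of_nat_mult)
  finally show ?thesis .
qed

lemma sum_fourier_exp_lattice:
  assumes "N > 0" and "h \<noteq> 0 \<Longrightarrow> \<not> int N dvd (\<Sum>j\<in>UNIV. h $ j * int (z $ j))"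
  shows "(\<Sum>n<N. fourier_exp h (lattice_point N z n)) / of_nat N = (if h = 0 then 1 else 0)"
proof (cases "h = 0")
  case True
  then show ?thesis
    using assms(1) by (simp add: fourier_exp_0)
next
  case False
  then have "(\<Sum>n<N. fourier_exp h (lattice_point N z n)) = 0"
    unfolding fourier_exp_lattice_point using assms by (intro sum_character) auto
  then show ?thesis
    using False by simp
qed

section \<open>Integrals of characters over the unit cube\<close>

lemma has_bochner_integral_character:
  fixes m :: int
  shows "has_bochner_integral lborel
    (\<lambda>t. indicator {0..<1} t *\<^sub>R exp (2 * of_real pi * \<i> * of_real (of_int m * t)))
    (if m = 0 then 1 else 0 :: complex)"
proof -
  let ?e = "\<lambda>t::real. exp (2 * of_real pi * \<i> * of_real (of_int m * t))"
  \<comment> \<open>An antiderivative of \<open>?e\<close>; for nonzero \<open>m\<close> it takes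
    equal values at 0 and 1 by periodicity.\<close>
  define F where "F t = (if m = 0 then of_real t else ?e t / (2 * of_real pi * \<i> * of_int m))" for t
  have "has_bochner_integral lborel (\<lambda>t. indicator {0..1} t *\<^sub>R ?e t) (F 1 - F 0)"
  proof (rule has_bochner_integral_FTC_Icc)
    show "continuous_on {0..1} ?e"
      by (intro continuous_intros)
    fix t :: real
    show "(F has_vector_derivative ?e t) (at t within {0..1})"
    proof (cases "m = 0")
      case True
      then have "F = of_real"
        by (simp add: F_def fun_eq_iff)
      then show ?thesis
        using True has_vector_derivative_of_real[OF DERIV_ident] by simp
    next
      case False
      let ?c = "2 * of_real pi * \<i> * of_int m"
      have "((\<lambda>w. exp (?c * w) / ?c) has_field_derivative exp (?c * of_real t)) (at (of_real t))"
        using False by (auto intro!: derivative_eq_intros simp: field_simps)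
      from has_vector_derivative_real_field[OF this] show ?thesis
        using False by (simp add: F_def[abs_def] mult_ac)
    qed
  qed simp
  also have "F 1 - F 0 = (if m = 0 then 1 else 0)"
  proof -
    have "?e 1 = 1"
      by (auto simp: exp_eq_1 intro: exI[of _ m])
    then show ?thesis
      by (simp add: F_def)
  qed
  finally have *: "has_bochner_integral lborel (\<lambda>t. indicator {0..1} t *\<^sub>R ?e t) (if m = 0 then 1 else 0)" .
  \<comment> \<open>The fundamental theorem is stated for closed intervals; the half-open one
    differs by the null set {1}.\<close>
  have "AE t in lborel. indicator {0..1} t *\<^sub>R ?e t = indicator {0..<1} t *\<^sub>R ?e t"
    using AE_lborel_singleton[of 1] by eventually_elim (auto simp: indicator_def)
  then show ?thesis
    using * by (subst has_bochner_integral_cong_AE[symmetric]) auto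
qed

text \<open>Fubini for a product of one-variable functions: \<open>lborel\<close> is the image under
  \<open>?T\<close> of the product measure on coordinate families.\<close>

lemma has_bochner_integral_lborel_prod:
  fixes g :: "'a::euclidean_space \<Rightarrow> real \<Rightarrow> 'b::{real_normed_field,banach,second_countable_topology}"
  assumes "\<And>b. b \<in> Basis \<Longrightarrow> has_bochner_integral lborel (g b) (v b)"
  shows "has_bochner_integral lborel (\<lambda>x. \<Prod>b\<in>Basis. g b (x \<bullet> b)) (\<Prod>b\<in>Basis. v b)"
proof -
  interpret product_sigma_finite "\<lambda>_::'a. lborel :: real measure"
    by unfold_locales
  let ?M = "\<Pi>\<^sub>M b\<in>(Basis::'a set). (lborel :: real measure)"
  let ?T = "\<lambda>f. \<Sum>b\<in>Basis. f b *\<^sub>R (b::'a)"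
  have int: "integrable lborel (g b)" and v: "integral\<^sup>L lborel (g b) = v b" if "b \<in> Basis" for b
    using assms[OF that] by (auto simp: has_bochner_integral_iff)
  have "has_bochner_integral ?M (\<lambda>x. \<Prod>b\<in>Basis. g b (x b)) (\<Prod>b\<in>Basis. v b)"
    using product_integral_prod[OF finite_Basis int] product_integrable_prod[OF finite_Basis int] v
    by (simp add: has_bochner_integral_iff)
  \<comment> \<open>Writing \<open>f b\<close> as a coordinate of \<open>?T f\<close> makes the
    integrand a function of the image point, as the change of variables requires.\<close>
  then have *: "has_bochner_integral ?M (\<lambda>f. \<Prod>b\<in>Basis. g b (?T f \<bullet> b)) (\<Prod>b\<in>Basis. v b)"
    by simp
  have g: "g b \<in> borel_measurable borel" if "b \<in> Basis" for b
    using int[OF that] by auto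
  have "(\<lambda>x::'a. \<Prod>b\<in>Basis. g b (x \<bullet> b)) \<in> borel_measurable borel"
    by (intro borel_measurable_prod measurable_compose[OF _ g]) auto
  moreover have "?T \<in> measurable ?M borel"
    by measurable
  ultimately show ?thesis
    by (subst lborel_eq) (use * in \<open>simp add: has_bochner_integral_iff integrable_distr_eq integral_distr\<close>)
qed

text \<open>Both the indicator and the exponential factor over the coordinates, which reduces the
  claim to dimension one.\<close>

lemma has_bochner_integral_fourier_exp:
  fixes h :: "int ^ 'd"
  shows "has_bochner_integral lborel (\<lambda>x. indicator unit_cube x *\<^sub>R fourier_exp h x) (if h = 0 then 1 else 0)"
proof -
  define H :: "real ^ 'd" where "H = (\<chi> j. of_int (h $ j))"
  \<comment> \<open>The product lemma is indexed by basis vectors rather than by \<open>'d\<close>;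
    the floor recovers the integer frequency belonging to \<open>b\<close>.\<close>
  have floor_H: "of_int \<lfloor>H \<bullet> b\<rfloor> = H \<bullet> b" if "b \<in> Basis" for b
    using that by (auto simp: Basis_vec_def inner_axis H_def)
  define g :: "real ^ 'd \<Rightarrow> real \<Rightarrow> complex" where
    "g b t = indicator {0..<1} t *\<^sub>R exp (2 * of_real pi * \<i> * of_real (of_int \<lfloor>H \<bullet> b\<rfloor> * t))" for b t
  have cube: "x \<in> unit_cube \<longleftrightarrow> (\<forall>b\<in>Basis. x \<bullet> b \<in> {0..<1})" for x :: "real ^ 'd"
    by (auto simp: unit_cube_def Basis_vec_def inner_axis)
  have ind: "indicator unit_cube x = (\<Prod>b\<in>Basis. indicator {0..<1} (x \<bullet> b) :: real)" for x :: "real ^ 'd"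
    using cube[of x] by (cases "x \<in> unit_cube") (auto simp: indicator_def intro!: prod_zero[symmetric])
  have H_inner: "(\<Sum>j\<in>UNIV. of_int (h $ j) * x $ j) = (\<Sum>b\<in>Basis. of_int \<lfloor>H \<bullet> b\<rfloor> * (x \<bullet> b))" for x
  proof -
    have "(\<Sum>j\<in>UNIV. of_int (h $ j) * x $ j) = H \<bullet> x"
      by (simp add: inner_vec_def H_def)
    then show ?thesis
      by (simp add: euclidean_inner[of H x] floor_H)
  qed
  have "fourier_exp h x = (\<Prod>b\<in>Basis. exp (2 * of_real pi * \<i> * of_real (of_int \<lfloor>H \<bullet> b\<rfloor> * (x \<bullet> b))))" for x
    unfolding fourier_exp_def H_inner by (simp add: exp_sum sum_distrib_left)
  then have "indicator unit_cube x *\<^sub>R fourier_exp h x = (\<Prod>b\<in>Basis. g b (x \<bullet> b))" for x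
    by (simp add: ind g_def scaleR_conv_of_real prod.distrib)
  moreover have "has_bochner_integral lborel (\<lambda>x. \<Prod>b\<in>Basis. g b (x \<bullet> b))
      (\<Prod>b\<in>Basis. if \<lfloor>H \<bullet> b\<rfloor> = 0 then 1 else 0)"
    unfolding g_def by (intro has_bochner_integral_lborel_prod has_bochner_integral_character)
  moreover have "(\<Prod>b\<in>Basis. if \<lfloor>H \<bullet> b\<rfloor> = 0 then 1 else 0 :: complex) = (if h = 0 then 1 else 0)"
  proof -
    have "(\<forall>b\<in>Basis. \<lfloor>H \<bullet> b\<rfloor> = 0) \<longleftrightarrow> h = 0"
      by (auto simp: Basis_vec_def inner_axis H_def vec_eq_iff)
    then show ?thesis
      by (auto intro!: prod.neutral prod_zero)
  qed
  ultimately show ?thesis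
    by simp
qed

section \<open>Exactness of the rule and the error bound\<close>

text \<open>Conjugation negates frequencies, so only differences of frequencies in \<open>I\<close>
  occur; hence the separation condition on differences.\<close>

lemma cmod_trig_poly_squared:
  "of_real ((cmod (\<Sum>h\<in>I. c h * fourier_exp h x))\<^sup>2) =
    (\<Sum>h\<in>I. \<Sum>k\<in>I. c h * cnj (c k) * fourier_exp (h - k) x)"
proof -
  have "c h * fourier_exp h x * cnj (c k * fourier_exp k x) = c h * cnj (c k) * fourier_exp (h - k) x" for h k
    by (simp add: fourier_exp_mult_cnj[symmetric])
  then show ?thesis
    by (simp only: complex_norm_square cnj_sum sum_product)
qed

text \<open>Rule and integral agree on every character with frequency \<open>h - k\<close>, so by
  linearity they agree on the squared modulus.\<close>

lemma lattice_rule_exact: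
  fixes z :: "nat ^ 'd" and I :: "(int ^ 'd) set"
  assumes "finite I" and "N > 0"
    and "\<And>h k. h \<in> I \<Longrightarrow> k \<in> I \<Longrightarrow> h \<noteq> k \<Longrightarrow> \<not> int N dvd (\<Sum>j\<in>UNIV. (h - k) $ j * int (z $ j))"
    and "p \<in> trig_polys I"
  shows "lattice_rule N z (\<lambda>x. (cmod (p x))\<^sup>2) = (LINT x:unit_cube|lborel. (cmod (p x))\<^sup>2)"
proof -
  obtain c where p: "p x = (\<Sum>h\<in>I. c h * fourier_exp h x)" for x
    using trig_polys_eq_sum[OF assms(1,4)] by blast
  \<comment> \<open>This is the sum of the squared moduli of the \<open>c h\<close>, kept as a
    double sum to match both computations term by term.\<close>
  let ?v = "\<Sum>h\<in>I. \<Sum>k\<in>I. c h * cnj (c k) * (if h - k = 0 then 1 else 0)"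
  have sq: "complex_of_real ((cmod (p x))\<^sup>2) = (\<Sum>h\<in>I. \<Sum>k\<in>I. c h * cnj (c k) * fourier_exp (h - k) x)" for x
    unfolding p by (rule cmod_trig_poly_squared)
  have "complex_of_real (lattice_rule N z (\<lambda>x. (cmod (p x))\<^sup>2)) =
      (\<Sum>n<N. \<Sum>h\<in>I. \<Sum>k\<in>I. c h * cnj (c k) * fourier_exp (h - k) (lattice_point N z n)) / of_nat N"
    by (simp add: lattice_rule_def sq[symmetric])
  also have "(\<Sum>n<N. \<Sum>h\<in>I. \<Sum>k\<in>I. c h * cnj (c k) * fourier_exp (h - k) (lattice_point N z n)) =
      (\<Sum>h\<in>I. \<Sum>k\<in>I. \<Sum>n<N. c h * cnj (c k) * fourier_exp (h - k) (lattice_point N z n))"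
    by (subst sum.swap) (intro sum.cong refl sum.swap)
  also have "\<dots> / of_nat N =
      (\<Sum>h\<in>I. \<Sum>k\<in>I. c h * cnj (c k) * ((\<Sum>n<N. fourier_exp (h - k) (lattice_point N z n)) / of_nat N))"
    by (simp add: sum_divide_distrib sum_distrib_left)
  also have "\<dots> = ?v"
    using assms(2,3) by (intro sum.cong arg_cong2[where f = "(*)"] sum_fourier_exp_lattice refl) auto
  finally have lattice: "complex_of_real (lattice_rule N z (\<lambda>x. (cmod (p x))\<^sup>2)) = ?v" .
  have "has_bochner_integral lborel
      (\<lambda>x. \<Sum>h\<in>I. \<Sum>k\<in>I. c h * cnj (c k) * (indicator unit_cube x *\<^sub>R fourier_exp (h - k) x)) ?v"
    by (intro has_bochner_integral_sum has_bochner_integral_mult_right has_bochner_integral_fourier_exp)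
  also have "(\<lambda>x. \<Sum>h\<in>I. \<Sum>k\<in>I. c h * cnj (c k) * (indicator unit_cube x *\<^sub>R fourier_exp (h - k) x)) =
      (\<lambda>x. complex_of_real (indicator unit_cube x *\<^sub>R (cmod (p x))\<^sup>2))"
    by (simp only: scaleR_conv_of_real[of _ "_ :: real"] of_real_mult sq)
       (simp add: scaleR_conv_of_real sum_distrib_left mult_ac)
  finally have "(LINT x|lborel. complex_of_real (indicator unit_cube x *\<^sub>R (cmod (p x))\<^sup>2)) = ?v"
    by (rule has_bochner_integral_integral_eq)
  then have "complex_of_real (LINT x:unit_cube|lborel. (cmod (p x))\<^sup>2) = ?v"
    unfolding set_lebesgue_integral_def by (simp only: integral_complex_of_real)
  then show ?thesis
    using lattice by (intro of_real_eq_iff[where 'a = complex, THEN iffD1]) (rule trans[OF _ sym])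
qed

theorem theorem3p6:
  fixes I :: "(int ^ 'd) set" and \<eta> \<alpha> :: real and \<gamma> :: "nat \<Rightarrow> real"
  assumes "0 < \<eta>" and "\<eta> < 1"
    and "finite I"
    and "\<alpha> > 1 / 2"
    and "\<forall>j\<ge>1. 0 \<le> \<gamma> j \<and> \<gamma> j \<le> 1"
  shows "\<exists>Nstar::nat. Nstar > 0 \<and>
    (\<forall>N. prime N \<and> N \<ge> Nstar \<longrightarrow>
      (\<exists>z :: nat ^ 'd. (\<forall>j. z $ j \<in> {1..N - 1}) \<and>
        (\<forall>p \<in> trig_polys I.
          \<bar>lattice_rule N z (\<lambda>x. (cmod (p x))\<^sup>2) - (LINT x:unit_cube|lborel. (cmod (p x))\<^sup>2)\<bar>
            \<le> \<eta> * (LINT x:unit_cube|lborel. (cmod (p x))\<^sup>2))))"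
proof -
  define D where "D = {h - k | h k. h \<in> I \<and> k \<in> I \<and> h \<noteq> k}"
  have "D \<subseteq> (\<lambda>(h, k). h - k) ` (I \<times> I)"
    by (auto simp: D_def)
  then have "finite D"
    by (rule finite_subset) (simp add: \<open>finite I\<close>)
  moreover have "0 \<notin> D"
    by (auto simp: D_def)
  ultimately obtain z :: "nat ^ 'd" where "(\<forall>j. 0 < z $ j) \<and> (\<forall>h\<in>D. (\<Sum>j\<in>UNIV. h $ j * int (z $ j)) \<noteq> 0)"
    by (rule exists_separating_vector[THEN exE])
  then have z: "\<forall>j. 0 < z $ j" and sep: "\<forall>h\<in>D. (\<Sum>j\<in>UNIV. h $ j * int (z $ j)) \<noteq> 0"
    by simp_all
  let ?m = "\<lambda>h :: int ^ 'd. \<Sum>j\<in>UNIV. h $ j * int (z $ j)"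
  \<comment> \<open>One \<open>z\<close> serves every \<open>N\<close>. The first sum bounds each
    entry of \<open>z\<close>, the second each absolute value of \<open>?m h\<close>;
    \<open>Suc\<close> makes both strictly smaller than \<open>N\<close>.\<close>
  define Nstar where "Nstar = Suc ((\<Sum>j\<in>UNIV. z $ j) + (\<Sum>h\<in>D. nat \<bar>?m h\<bar>))"
  have "\<forall>j. z $ j \<in> {1..N - 1}" if "N \<ge> Nstar" for N
  proof
    fix j
    have "z $ j \<le> (\<Sum>j\<in>UNIV. z $ j)"
      by (intro member_le_sum) auto
    then show "z $ j \<in> {1..N - 1}"
      using that spec[OF z, of j] by (auto simp: Nstar_def)
  qed
  moreover have "lattice_rule N z (\<lambda>x. (cmod (p x))\<^sup>2) = (LINT x:unit_cube|lborel. (cmod (p x))\<^sup>2)"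
    if N: "N \<ge> Nstar" and p: "p \<in> trig_polys I" for N p
  proof (rule lattice_rule_exact[OF \<open>finite I\<close> _ _ p])
    show "N > 0"
      using N by (auto simp: Nstar_def)
    fix h k assume "h \<in> I" "k \<in> I" "h \<noteq> k"
    then have hk: "h - k \<in> D"
      by (auto simp: D_def)
    then have "nat \<bar>?m (h - k)\<bar> \<le> (\<Sum>h\<in>D. nat \<bar>?m h\<bar>)"
      using \<open>finite D\<close> by (intro member_le_sum) auto
    then have "\<bar>?m (h - k)\<bar> < int N"
      using N by (simp add: Nstar_def)
    \<comment> \<open>A nonzero multiple of \<open>N\<close> has absolute value at least
      \<open>N\<close>.\<close>
    then show "\<not> int N dvd ?m (h - k)"
      using bspec[OF sep hk] dvd_imp_le_int[of "?m (h - k)" "int N"] by auto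
  qed
  \<comment> \<open>The error is 0, so the bound only asks that its right-hand side be
    nonnegative.\<close>
  moreover have "0 \<le> (LINT x:unit_cube|lborel. (cmod (p x))\<^sup>2)" for p :: "real ^ 'd \<Rightarrow> complex"
    unfolding set_lebesgue_integral_def by (intro Bochner_Integration.integral_nonneg) simp
  moreover have "Nstar > 0"
    by (simp add: Nstar_def)
  ultimately show ?thesis
    using \<open>0 < \<eta>\<close> by (intro exI[of _ Nstar] conjI allI impI exI[of _ z] ballI) auto
qed

end
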